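(* Let $\hbar,m>0$, let $\alpha,\beta,\gamma,\delta:\mathbb{R}^2\to\mathbb{R}$ be smooth functions of $(x,t)$, and let $\psi=\mathrm{e}^{\alpha+\beta\mathbf{i_1}+\gamma\mathbf{i_2}+\delta\mathbf{j}}:\mathbb{R}^2\to\mathbb{T}$. Set $\psi_\pm=\mathrm{e}^{(\alpha\pm\delta)+(\beta\mp\gamma)\mathbf{i_1}}$. Then $$\hat P_1(\psi)=\psi^{\dag_2},\qquad \hat P_2(\psi)=\psi_+,\qquad \hat P_3(\psi)=\psi_-.$$ Consequently, replacing $\psi$ by $\hat P_n(\psi)$ in the two continuity equations $$(E_1)\quad \partial_t(\psi\psi^{\dag_1})+\partial_x\left[\frac{\hbar}{2m\mathbf{i_1}}(\psi^{\dag_1}\partial_x\psi-\psi\,\partial_x\psi^{\dag_1})\right]=0,$$ $$(E_2)\quad \partial_t(\psi\psi^{\dag_3})+\partial_x\left[\frac{\hbar}{2m\mathbf{i_1}}(\psi^{\dag_3}\partial_x\psi-\psi\,\partial_x\psi^{\dag_3})\right]=0$$ has the following effect. (a) $\hat P_1$ transforms $(E_1)$ into $$\partial_t(\psi^{\dag_2}\psi^{\dag_3})+\partial_x\left[\frac{\hbar}{2m\mathbf{i_1}}(\psi^{\dag_3}\partial_x\psi^{\dag_2}-\psi^{\dag_2}\partial_x\psi^{\dag_3})\right]=0$$ and $(E_2)$ into $$\partial_t(\psi^{\dag_2}\psi^{\dag_1})+\partial_x\left[\frac{\hbar}{2m\mathbf{i_1}}(\psi^{\dag_1}\partial_x\psi^{\dag_2}-\psi^{\dag_2}\partial_x\psi^{\dag_1})\right]=0.$$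 (b) $\hat P_2$ transforms both $(E_1)$ and $(E_2)$ into $\partial_t(\psi_+\overline{\psi_+})+\partial_xJ(\psi_+)=0$, where $$J(\psi_+)=\frac{\hbar}{2m\mathbf{i_1}}(\overline{\psi_+}\,\partial_x\psi_+-\psi_+\,\partial_x\overline{\psi_+})=\frac{\hbar}{m}\mathrm{e}^{2(\alpha+\delta)}\partial_x(\beta-\gamma)$$ is real valued. (c) $\hat P_3$ transforms both $(E_1)$ and $(E_2)$ into $\partial_t(\psi_-\overline{\psi_-})+\partial_xJ(\psi_-)=0$, where $$J(\psi_-)=\frac{\hbar}{2m\mathbf{i_1}}(\overline{\psi_-}\,\partial_x\psi_--\psi_-\,\partial_x\overline{\psi_-})=\frac{\hbar}{m}\mathrm{e}^{2(\alpha-\delta)}\partial_x(\beta+\gamma)$$ is real valued.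
   Context: The bicomplex numbers are the commutative ring $\mathbb{T}=\{w_0+w_1\mathbf{i_1}+w_2\mathbf{i_2}+w_3\mathbf{j}: w_0,\dots,w_3\in\mathbb{R}\}$ with $\mathbf{i_1}^2=\mathbf{i_2}^2=-1$, $\mathbf{j}^2=1$, $\mathbf{i_1}\mathbf{i_2}=\mathbf{i_2}\mathbf{i_1}=\mathbf{j}$, $\mathbf{i_1}\mathbf{j}=\mathbf{j}\mathbf{i_1}=-\mathbf{i_2}$, $\mathbf{i_2}\mathbf{j}=\mathbf{j}\mathbf{i_2}=-\mathbf{i_1}$. The conjugations of $w=w_0+w_1\mathbf{i_1}+w_2\mathbf{i_2}+w_3\mathbf{j}$ are $w^{\dag_1}=w_0-w_1\mathbf{i_1}+w_2\mathbf{i_2}-w_3\mathbf{j}$, $w^{\dag_2}=w_0+w_1\mathbf{i_1}-w_2\mathbf{i_2}-w_3\mathbf{j}$, $w^{\dag_3}=w_0-w_1\mathbf{i_1}-w_2\mathbf{i_2}+w_3\mathbf{j}$. The subring $\mathbb{C}(\mathbf{i_1})=\{x+y\mathbf{i_1}:x,y\in\mathbb{R}\}$ is a copy of the complex numbers, with conjugation $\overline{x+y\mathbf{i_1}}=x-y\mathbf{i_1}$. The exponential is the usual power series; derivatives of $\mathbb{T}$-valued functions are componentwise. For $n=1,2,3$ the function $\hat P_n(\psi)$ is obtained from $\mathrm{e}^{\alpha+\beta\mathbf{i_1}+\gamma\mathbf{i_2}+\delta\mathbf{j}}$ by keeping $\alpha,\beta$ and replacing $(\gamma,\delta)$ by: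 $(-\gamma,-\delta)$ for $n=1$; $(-\delta\mathbf{i_2},\gamma\mathbf{i_2})$ for $n=2$; $(\delta\mathbf{i_2},-\gamma\mathbf{i_2})$ for $n=3$ (products taken in $\mathbb{T}$). *)

theory Defs
  imports "HOL-Analysis.Analysis"
begin

section \<open>The bicomplex numbers\<close>

datatype bicomplex = Bicomplex (bc0: real) (bc1: real) (bc2: real) (bc3: real)

lemma bicomplex_eq_iff:
  "w = z \<longleftrightarrow> bc0 w = bc0 z \<and> bc1 w = bc1 z \<and> bc2 w = bc2 z \<and> bc3 w = bc3 z"
  by (cases w; cases z) auto

instantiation bicomplex :: comm_ring_1
begin

definition "0 = Bicomplex 0 0 0 0"
definition "1 = Bicomplex 1 0 0 0"
definition "w + z = Bicomplex (bc0 w + bc0 z) (bc1 w + bc1 z) (bc2 w + bc2 z) (bc3 w + bc3 z)"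
definition "w - z = Bicomplex (bc0 w - bc0 z) (bc1 w - bc1 z) (bc2 w - bc2 z) (bc3 w - bc3 z)"
definition "- w = Bicomplex (- bc0 w) (- bc1 w) (- bc2 w) (- bc3 w)"
definition "w * z = Bicomplex
  (bc0 w * bc0 z - bc1 w * bc1 z - bc2 w * bc2 z + bc3 w * bc3 z)
  (bc0 w * bc1 z + bc1 w * bc0 z - bc2 w * bc3 z - bc3 w * bc2 z)
  (bc0 w * bc2 z + bc2 w * bc0 z - bc1 w * bc3 z - bc3 w * bc1 z)
  (bc0 w * bc3 z + bc3 w * bc0 z + bc1 w * bc2 z + bc2 w * bc1 z)"

instance
  by standard
    (simp_all (no_asm) add: bicomplex_eq_iff zero_bicomplex_def one_bicomplex_def plus_bicomplex_def
      minus_bicomplex_def uminus_bicomplex_def times_bicomplex_def algebra_simps)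

end

lemma bc_ring_simps [simp]:
  "bc0 0 = 0" "bc1 0 = 0" "bc2 0 = 0" "bc3 0 = 0"
  "bc0 1 = 1" "bc1 1 = 0" "bc2 1 = 0" "bc3 1 = 0"
  "bc0 (w + z) = bc0 w + bc0 z" "bc1 (w + z) = bc1 w + bc1 z"
  "bc2 (w + z) = bc2 w + bc2 z" "bc3 (w + z) = bc3 w + bc3 z"
  "bc0 (w - z) = bc0 w - bc0 z" "bc1 (w - z) = bc1 w - bc1 z"
  "bc2 (w - z) = bc2 w - bc2 z" "bc3 (w - z) = bc3 w - bc3 z"
  "bc0 (- w) = - bc0 w" "bc1 (- w) = - bc1 w" "bc2 (- w) = - bc2 w" "bc3 (- w) = - bc3 w"
  "bc0 (w * z) = bc0 w * bc0 z - bc1 w * bc1 z - bc2 w * bc2 z + bc3 w * bc3 z"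
  "bc1 (w * z) = bc0 w * bc1 z + bc1 w * bc0 z - bc2 w * bc3 z - bc3 w * bc2 z"
  "bc2 (w * z) = bc0 w * bc2 z + bc2 w * bc0 z - bc1 w * bc3 z - bc3 w * bc1 z"
  "bc3 (w * z) = bc0 w * bc3 z + bc3 w * bc0 z + bc1 w * bc2 z + bc2 w * bc1 z"
  by (simp_all add: zero_bicomplex_def one_bicomplex_def plus_bicomplex_def
      minus_bicomplex_def uminus_bicomplex_def times_bicomplex_def)

instantiation bicomplex :: real_algebra_1
begin

definition "r *\<^sub>R w = Bicomplex (r * bc0 w) (r * bc1 w) (r * bc2 w) (r * bc3 w)"

instance
  by standard (simp_all add: bicomplex_eq_iff scaleR_bicomplex_def algebra_simps)

end

text \<open>
  The type is made a Banach algebra so that the library's power series \<^const>\<open>exp\<close> is available.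
  The class requires a submultiplicative norm, which the Euclidean norm of the four components
  is not; the sum norm is, and it induces the same topology.
\<close>

instantiation bicomplex :: real_normed_algebra_1
begin

definition "norm w = \<bar>bc0 w\<bar> + \<bar>bc1 w\<bar> + \<bar>bc2 w\<bar> + \<bar>bc3 w\<bar>"
definition "sgn (w::bicomplex) = w /\<^sub>R norm w"
definition "dist (w::bicomplex) z = norm (w - z)"
definition "(uniformity :: (bicomplex \<times> bicomplex) filter) =
  (INF e\<in>{0 <..}. principal {(w, z). dist w z < e})"
definition "open (U :: bicomplex set) \<longleftrightarrow>
  (\<forall>w\<in>U. \<forall>\<^sub>F (w', z) in uniformity. w' = w \<longrightarrow> z \<in> U)"

instance
proof
  fix r s :: real and w z :: bicomplex and U :: "bicomplex set"
  show "dist w z = norm (w - z)" "sgn w = w /\<^sub>R norm w"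
    "(uniformity :: (bicomplex \<times> bicomplex) filter) =
       (INF e\<in>{0 <..}. principal {(w, z). dist w z < e})"
    "open U \<longleftrightarrow> (\<forall>w\<in>U. \<forall>\<^sub>F (w', z) in uniformity. w' = w \<longrightarrow> z \<in> U)"
    by (rule dist_bicomplex_def sgn_bicomplex_def uniformity_bicomplex_def open_bicomplex_def)+
  show "(norm w = 0) = (w = 0)"
    by (auto simp: norm_bicomplex_def bicomplex_eq_iff)
  show "norm (w + z) \<le> norm w + norm z"
    using abs_triangle_ineq[of "bc0 w" "bc0 z"] abs_triangle_ineq[of "bc1 w" "bc1 z"]
      abs_triangle_ineq[of "bc2 w" "bc2 z"] abs_triangle_ineq[of "bc3 w" "bc3 z"]
    unfolding norm_bicomplex_def bc_ring_simps by argo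
  show "norm (r *\<^sub>R w) = \<bar>r\<bar> * norm w"
    by (simp add: norm_bicomplex_def scaleR_bicomplex_def abs_mult algebra_simps)
  show "norm (w * z) \<le> norm w * norm z"
  proof -
    have tri: "\<bar>a\<bar> + \<bar>b\<bar> + \<bar>c\<bar> + \<bar>d\<bar> \<le> n"
      if "\<bar>a\<bar> \<le> a1 + a2 + a3 + a4" "\<bar>b\<bar> \<le> b1 + b2 + b3 + b4"
        "\<bar>c\<bar> \<le> c1 + c2 + c3 + c4" "\<bar>d\<bar> \<le> d1 + d2 + d3 + d4"
        "n = (a1 + a2 + a3 + a4) + (b1 + b2 + b3 + b4) + (c1 + c2 + c3 + c4) + (d1 + d2 + d3 + d4)"
      for a b c d n a1 a2 a3 a4 b1 b2 b3 b4 c1 c2 c3 c4 d1 d2 d3 d4 :: real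
      using that by argo
    have four: "\<bar>a - b - c + d\<bar> \<le> \<bar>a\<bar> + \<bar>b\<bar> + \<bar>c\<bar> + \<bar>d\<bar>"
      "\<bar>a + b - c - d\<bar> \<le> \<bar>a\<bar> + \<bar>b\<bar> + \<bar>c\<bar> + \<bar>d\<bar>"
      "\<bar>a + b + c + d\<bar> \<le> \<bar>a\<bar> + \<bar>b\<bar> + \<bar>c\<bar> + \<bar>d\<bar>" for a b c d :: real
      by (simp_all add: abs_if)
    show ?thesis
      unfolding norm_bicomplex_def bc_ring_simps
      by (rule tri[OF four(1) four(2) four(2) four(3)])
        (simp only: abs_mult ring_distribs ac_simps)
  qed
  show "norm (1 :: bicomplex) = 1"
    by (simp add: norm_bicomplex_def)
qed

end

lemma bc_scaleR [simp]:
  "bc0 (r *\<^sub>R w) = r * bc0 w" "bc1 (r *\<^sub>R w) = r * bc1 w"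
  "bc2 (r *\<^sub>R w) = r * bc2 w" "bc3 (r *\<^sub>R w) = r * bc3 w"
  by (simp_all add: scaleR_bicomplex_def)

lemma bc_of_real [simp]:
  "bc0 (of_real r) = r" "bc1 (of_real r) = 0" "bc2 (of_real r) = 0" "bc3 (of_real r) = 0"
  by (simp_all add: of_real_def)

lemma bounded_linear_bc:
  "bounded_linear bc0" "bounded_linear bc1" "bounded_linear bc2" "bounded_linear bc3"
  by (rule bounded_linear_intro[where K = 1]; simp add: norm_bicomplex_def)+

instance bicomplex :: banach
proof
  fix X :: "nat \<Rightarrow> bicomplex"
  assume X: "Cauchy X"
  define L where "L = Bicomplex (lim (\<lambda>n. bc0 (X n))) (lim (\<lambda>n. bc1 (X n)))
    (lim (\<lambda>n. bc2 (X n))) (lim (\<lambda>n. bc3 (X n)))"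
  have lim: "(\<lambda>n. f (X n)) \<longlonglongrightarrow> lim (\<lambda>n. f (X n))" if "bounded_linear f"
    for f :: "bicomplex \<Rightarrow> real"
    using bounded_linear.Cauchy[OF that X] by (simp add: Cauchy_convergent_iff convergent_LIMSEQ_iff)
  have "(\<lambda>n. \<bar>f (X n) - lim (\<lambda>n. f (X n))\<bar>) \<longlonglongrightarrow> 0" if "bounded_linear f"
    for f :: "bicomplex \<Rightarrow> real"
    using lim[OF that] by (simp add: LIM_zero tendsto_rabs_zero)
  note lim0 = this[OF bounded_linear_bc(1)] this[OF bounded_linear_bc(2)]
    this[OF bounded_linear_bc(3)] this[OF bounded_linear_bc(4)]
  have "(\<lambda>n. norm (X n - L)) \<longlonglongrightarrow> 0"
    unfolding norm_bicomplex_def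
    using tendsto_add[OF tendsto_add[OF tendsto_add[OF lim0(1,2)] lim0(3)] lim0(4)]
    by (simp add: L_def)
  then show "convergent X"
    by (auto simp: convergent_def intro: LIM_zero_cancel tendsto_norm_zero_cancel)
qed

text \<open>
  Since the ring is not a field, division is meaningful for invertible divisors only; division
  by a non-unit is set to 0.
\<close>

instantiation bicomplex :: inverse
begin

definition "inverse (w :: bicomplex) =
  (if \<exists>v. w * v = 1 then THE v. w * v = 1 else 0)"
definition "divide (u :: bicomplex) w = u * inverse w"

instance ..

end

definition i1 :: bicomplex where "i1 = Bicomplex 0 1 0 0"
definition i2 :: bicomplex where "i2 = Bicomplex 0 0 1 0"
definition jj :: bicomplex where "jj = Bicomplex 0 0 0 1"

lemma bicomplex_expand:
  "w = of_real (bc0 w) + of_real (bc1 w) * i1 + of_real (bc2 w) * i2 + of_real (bc3 w) * jj"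
  by (simp add: bicomplex_eq_iff i1_def i2_def jj_def)

lemma bicomplex_mult_table:
  "i1 * i1 = - 1" "i2 * i2 = - 1" "jj * jj = 1"
  "i1 * i2 = jj" "i2 * i1 = jj" "i1 * jj = - i2" "jj * i1 = - i2" "i2 * jj = - i1" "jj * i2 = - i1"
  by (simp_all add: bicomplex_eq_iff i1_def i2_def jj_def)

lemma bicomplex_inverse_eqI: "inverse w = v" if "w * v = 1" for w v :: bicomplex
proof -
  have "v' = v" if "w * v' = 1" for v'
    using \<open>w * v = 1\<close> that by (metis mult.left_commute mult.right_neutral)
  then have "(THE v. w * v = 1) = v"
    using that by blast
  then show ?thesis
    using that by (auto simp: inverse_bicomplex_def)
qed

definition dag1 :: "bicomplex \<Rightarrow> bicomplex" where
  "dag1 w = Bicomplex (bc0 w) (- bc1 w) (bc2 w) (- bc3 w)"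

definition dag2 :: "bicomplex \<Rightarrow> bicomplex" where
  "dag2 w = Bicomplex (bc0 w) (bc1 w) (- bc2 w) (- bc3 w)"

definition dag3 :: "bicomplex \<Rightarrow> bicomplex" where
  "dag3 w = Bicomplex (bc0 w) (- bc1 w) (- bc2 w) (bc3 w)"

definition C_i1 :: "bicomplex set" where
  "C_i1 = {of_real x + of_real y * i1 | x y. True}"

text \<open>Complex conjugation of \<^const>\<open>C_i1\<close>; its value outside that subring carries no meaning.\<close>

definition cnj_i1 :: "bicomplex \<Rightarrow> bicomplex" where
  "cnj_i1 w = of_real (bc0 w) - of_real (bc1 w) * i1"


section \<open>Partial derivatives and smoothness on the plane\<close>

text \<open>A point of the plane is a pair \<open>(x, t)\<close>.\<close>

definition pdx :: "(real \<times> real \<Rightarrow> real) \<Rightarrow> real \<times> real \<Rightarrow> real" where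
  "pdx f p = deriv (\<lambda>x. f (x, snd p)) (fst p)"

definition pdt :: "(real \<times> real \<Rightarrow> real) \<Rightarrow> real \<times> real \<Rightarrow> real" where
  "pdt f p = deriv (\<lambda>t. f (fst p, t)) (snd p)"

definition bpdx :: "(real \<times> real \<Rightarrow> bicomplex) \<Rightarrow> real \<times> real \<Rightarrow> bicomplex" where
  "bpdx \<phi> p = Bicomplex (pdx (bc0 \<circ> \<phi>) p) (pdx (bc1 \<circ> \<phi>) p) (pdx (bc2 \<circ> \<phi>) p) (pdx (bc3 \<circ> \<phi>) p)"

definition bpdt :: "(real \<times> real \<Rightarrow> bicomplex) \<Rightarrow> real \<times> real \<Rightarrow> bicomplex" where
  "bpdt \<phi> p = Bicomplex (pdt (bc0 \<circ> \<phi>) p) (pdt (bc1 \<circ> \<phi>) p) (pdt (bc2 \<circ> \<phi>) p) (pdt (bc3 \<circ> \<phi>) p)"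

primrec C_k :: "nat \<Rightarrow> (real \<times> real \<Rightarrow> real) \<Rightarrow> bool" where
  "C_k 0 f \<longleftrightarrow> continuous_on UNIV f"
| "C_k (Suc k) f \<longleftrightarrow> f differentiable_on UNIV \<and> C_k k (pdx f) \<and> C_k k (pdt f)"

definition smooth :: "(real \<times> real \<Rightarrow> real) \<Rightarrow> bool" where
  "smooth f \<longleftrightarrow> (\<forall>k. C_k k f)"


section \<open>The wave function and its transforms\<close>

text \<open>
  The exponential with bicomplex-valued coefficient functions: the transforms below
  substitute non-real values for the coefficients of \<^const>\<open>i2\<close> and \<^const>\<open>jj\<close>.
\<close>

definition exp_form ::
  "(real \<times> real \<Rightarrow> bicomplex) \<Rightarrow> (real \<times> real \<Rightarrow> bicomplex) \<Rightarrow> (real \<times> real \<Rightarrow> bicomplex) \<Rightarrow>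
   (real \<times> real \<Rightarrow> bicomplex) \<Rightarrow> real \<times> real \<Rightarrow> bicomplex" where
  "exp_form a b c d = (\<lambda>p. exp (a p + b p * i1 + c p * i2 + d p * jj))"

context
  fixes \<alpha> \<beta> \<gamma> \<delta> :: "real \<times> real \<Rightarrow> real"
begin

definition psi :: "real \<times> real \<Rightarrow> bicomplex" where
  "psi = exp_form (\<lambda>p. of_real (\<alpha> p)) (\<lambda>p. of_real (\<beta> p)) (\<lambda>p. of_real (\<gamma> p)) (\<lambda>p. of_real (\<delta> p))"

definition psi_plus :: "real \<times> real \<Rightarrow> bicomplex" where
  "psi_plus = (\<lambda>p. exp (of_real (\<alpha> p + \<delta> p) + of_real (\<beta> p - \<gamma> p) * i1))"

definition psi_minus :: "real \<times> real \<Rightarrow> bicomplex" where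
  "psi_minus = (\<lambda>p. exp (of_real (\<alpha> p - \<delta> p) + of_real (\<beta> p + \<gamma> p) * i1))"

text \<open>The transforms act on the exponent, hence on the quadruple of functions defining \<^const>\<open>psi\<close>.\<close>

definition phat1 :: "real \<times> real \<Rightarrow> bicomplex" where
  "phat1 = exp_form (\<lambda>p. of_real (\<alpha> p)) (\<lambda>p. of_real (\<beta> p))
     (\<lambda>p. - of_real (\<gamma> p)) (\<lambda>p. - of_real (\<delta> p))"

definition phat2 :: "real \<times> real \<Rightarrow> bicomplex" where
  "phat2 = exp_form (\<lambda>p. of_real (\<alpha> p)) (\<lambda>p. of_real (\<beta> p))
     (\<lambda>p. - (of_real (\<delta> p) * i2)) (\<lambda>p. of_real (\<gamma> p) * i2)"

definition phat3 :: "real \<times> real \<Rightarrow> bicomplex" where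
  "phat3 = exp_form (\<lambda>p. of_real (\<alpha> p)) (\<lambda>p. of_real (\<beta> p))
     (\<lambda>p. of_real (\<delta> p) * i2) (\<lambda>p. - (of_real (\<gamma> p) * i2))"

end


section \<open>Continuity equations\<close>

context
  fixes hbar m :: real
begin

definition current ::
  "(real \<times> real \<Rightarrow> bicomplex) \<Rightarrow> (real \<times> real \<Rightarrow> bicomplex) \<Rightarrow> real \<times> real \<Rightarrow> bicomplex" where
  "current \<phi> \<eta> = (\<lambda>p. of_real hbar / (2 * of_real m * i1) * (\<eta> p * bpdx \<phi> p - \<phi> p * bpdx \<eta> p))"

text \<open>
  All the equations considered are of the form
  \<open>\<partial>\<^sub>t (\<phi> \<eta>) + \<partial>\<^sub>x [hbar / (2 m i1) (\<eta> \<partial>\<^sub>x \<phi> - \<phi> \<partial>\<^sub>x \<eta>)] = 0\<close>.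
  The left-hand sides are named separately: that a substitution turns one equation into another
  means that the left-hand sides agree, which is more than equivalence of the equations.
\<close>

definition continuity_lhs ::
  "(real \<times> real \<Rightarrow> bicomplex) \<Rightarrow> (real \<times> real \<Rightarrow> bicomplex) \<Rightarrow> real \<times> real \<Rightarrow> bicomplex" where
  "continuity_lhs \<phi> \<eta> = (\<lambda>p. bpdt (\<lambda>q. \<phi> q * \<eta> q) p + bpdx (current \<phi> \<eta>) p)"

definition continuity_eq ::
  "(real \<times> real \<Rightarrow> bicomplex) \<Rightarrow> (real \<times> real \<Rightarrow> bicomplex) \<Rightarrow> bool" where
  "continuity_eq \<phi> \<eta> \<longleftrightarrow> (\<forall>p. continuity_lhs \<phi> \<eta> p = 0)"

definition E1_lhs :: "(real \<times> real \<Rightarrow> bicomplex) \<Rightarrow> real \<times> real \<Rightarrow> bicomplex" where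
  "E1_lhs \<phi> = continuity_lhs \<phi> (dag1 \<circ> \<phi>)"

definition E1 :: "(real \<times> real \<Rightarrow> bicomplex) \<Rightarrow> bool" where
  "E1 \<phi> \<longleftrightarrow> (\<forall>p. E1_lhs \<phi> p = 0)"

definition E2_lhs :: "(real \<times> real \<Rightarrow> bicomplex) \<Rightarrow> real \<times> real \<Rightarrow> bicomplex" where
  "E2_lhs \<phi> = continuity_lhs \<phi> (dag3 \<circ> \<phi>)"

definition E2 :: "(real \<times> real \<Rightarrow> bicomplex) \<Rightarrow> bool" where
  "E2 \<phi> \<longleftrightarrow> (\<forall>p. E2_lhs \<phi> p = 0)"

text \<open>The current of a \<^const>\<open>C_i1\<close>-valued function.\<close>

definition J :: "(real \<times> real \<Rightarrow> bicomplex) \<Rightarrow> real \<times> real \<Rightarrow> bicomplex" where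
  "J \<phi> = current \<phi> (cnj_i1 \<circ> \<phi>)"

end

end

(*
  Being a continuous algebra endomorphism, dag2 commutes with the exponential series, which gives
  P1. For P2 and P3 the products with i2 collapse the exponent into C(i1), where dag1 and dag3
  both restrict to complex conjugation, so E1 and E2 become the same equation. Writing
  phi = exp (a + b i1), the bracket conj(phi) phi' - phi conj(phi') is 2 i1 times
  Im (conj(phi) phi') = exp (2 a) b'.
*)
theory Submission imports Defs begin

text \<open>Boundedness lets \<open>f\<close> pass through the convergent exponential series,
  multiplicativity and \<open>f 1 = 1\<close> carry each power over, and limits are unique. It
  serves both \<open>dag2\<close> and the embedding of the complex numbers.\<close>

lemma exp_bounded_linear_hom:
  fixes f :: "'a::{real_normed_algebra_1,banach} \<Rightarrow> 'b::{real_normed_algebra_1,banach}"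
  assumes lin: "bounded_linear f" and one: "f 1 = 1" and mult: "\<And>x y. f (x * y) = f x * f y"
  shows "exp (f x) = f (exp x)"
proof -
  interpret bounded_linear f by (rule lin)
  have pow: "f (x ^ n) = f x ^ n" for n
    by (induction n) (simp_all add: one mult)
  have "(\<lambda>n. f (x ^ n /\<^sub>R fact n)) sums f (exp x)"
    by (rule sums[OF exp_converges])
  then show ?thesis
    using exp_converges[of "f x"] by (simp add: scaleR pow sums_unique2)
qed

text \<open>The ring embedding of the type \<open>complex\<close> with image in \<open>C_i1\<close>.
  Through it, exponentials in \<open>C_i1\<close> are computed by the Euler formulas for complex
  numbers.\<close>

definition bc_of_complex :: "complex \<Rightarrow> bicomplex" where
  "bc_of_complex z = Bicomplex (Re z) (Im z) 0 0"

lemma bc_of_complex_sel [simp]: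
  "bc0 (bc_of_complex z) = Re z" "bc1 (bc_of_complex z) = Im z"
  "bc2 (bc_of_complex z) = 0" "bc3 (bc_of_complex z) = 0"
  by (simp_all add: bc_of_complex_def)

lemma bounded_linear_bc_of_complex: "bounded_linear bc_of_complex"
\<comment> \<open>The sum norm adds the real and imaginary parts, each bounded by the modulus, hence
  the constant 2.\<close>
proof (rule bounded_linear_intro[where K = 2])
  show "norm (bc_of_complex z) \<le> norm z * 2" for z
    using abs_Re_le_cmod[of z] abs_Im_le_cmod[of z] by (simp add: norm_bicomplex_def)
qed (simp_all add: bicomplex_eq_iff)

lemma exp_bc_of_complex: "exp (bc_of_complex z) = bc_of_complex (exp z)"
  by (rule exp_bounded_linear_hom[OF bounded_linear_bc_of_complex])
    (simp_all add: bicomplex_eq_iff)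

lemma bc_of_complex_in_C_i1: "bc_of_complex z \<in> C_i1"
  unfolding C_i1_def by (auto simp: bicomplex_eq_iff i1_def)

text \<open>With vanishing \<open>i2\<close> and \<open>jj\<close> components, all that remains of
  these maps is the sign change of \<open>i1\<close>.\<close>

lemma bc_of_complex_conjugations:
  "dag1 (bc_of_complex z) = bc_of_complex (cnj z)"
  "dag3 (bc_of_complex z) = bc_of_complex (cnj z)"
  "cnj_i1 (bc_of_complex z) = bc_of_complex (cnj z)"
  by (simp_all add: bicomplex_eq_iff dag1_def dag3_def cnj_i1_def i1_def)

lemma exp_dag2: "exp (dag2 w) = dag2 (exp w)"
proof (rule exp_bounded_linear_hom)
  show "bounded_linear dag2"
    by (rule bounded_linear_intro[where K = 1])
      (simp_all add: bicomplex_eq_iff dag2_def norm_bicomplex_def)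
qed (simp_all add: bicomplex_eq_iff dag2_def algebra_simps)

text \<open>The conjugations and the identity form a Klein four-group. This is why the first
  transform exchanges the partners \<open>dag1\<close> and \<open>dag3\<close> in the two
  equations.\<close>

lemma dag_comp_dag2: "dag1 \<circ> (dag2 \<circ> \<phi>) = dag3 \<circ> \<phi>" "dag3 \<circ> (dag2 \<circ> \<phi>) = dag1 \<circ> \<phi>"
  by (simp_all add: fun_eq_iff dag1_def dag2_def dag3_def)

lemma phat1_eq_dag2_psi: "phat1 \<alpha> \<beta> \<gamma> \<delta> = dag2 \<circ> psi \<alpha> \<beta> \<gamma> \<delta>"
  unfolding phat1_def psi_def exp_form_def o_def exp_dag2[symmetric]
  by (intro ext arg_cong[where f = exp])
    (simp add: bicomplex_eq_iff dag2_def i1_def i2_def jj_def)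

text \<open>Since \<open>i2 * i2 = - 1\<close> and \<open>i2 * jj = - i1\<close>, the last two terms
  of the exponent become \<delta> and \<open>- \<gamma> * i1\<close>. For \<open>phat3\<close> both
  signs are reversed.\<close>

lemma phat2_eq_psi_plus: "phat2 \<alpha> \<beta> \<gamma> \<delta> = psi_plus \<alpha> \<beta> \<gamma> \<delta>"
  unfolding phat2_def psi_plus_def exp_form_def
  by (intro ext arg_cong[where f = exp]) (simp add: bicomplex_eq_iff i1_def i2_def jj_def)

lemma phat3_eq_psi_minus: "phat3 \<alpha> \<beta> \<gamma> \<delta> = psi_minus \<alpha> \<beta> \<gamma> \<delta>"
  unfolding phat3_def psi_minus_def exp_form_def
  by (intro ext arg_cong[where f = exp]) (simp add: bicomplex_eq_iff i1_def i2_def jj_def)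

lemma exp_C_i1: "exp (of_real a + of_real b * i1) = bc_of_complex (exp (Complex a b))"
  unfolding exp_bc_of_complex[symmetric]
  by (intro arg_cong[where f = exp]) (simp add: bicomplex_eq_iff i1_def)

text \<open>The first level of the \<open>C_k\<close> hierarchy gives total differentiability in the
  plane, which the chain rule restricts to a line of constant t.\<close>

lemma smooth_imp_differentiable_x:
  assumes "smooth f"
  shows "(\<lambda>x. f (x, t)) differentiable at x"
proof -
  have "C_k (Suc 0) f"
    using assms by (simp only: smooth_def)
  then have "f differentiable at (x, t)"
    by (simp add: differentiable_on_def)
  then show ?thesis
    by (rule differentiable_compose[where g = "\<lambda>x. (x, t)"]) (auto intro!: derivative_intros)
qed

text \<open>For nonzero \<open>m\<close> the divisor is a unit, so the default value 0 of
  \<open>inverse\<close> does not arise, and 1 / \<open>i1\<close> is \<open>- i1\<close>.\<close>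

lemma divide_2_of_real_i1:
  assumes "m \<noteq> 0"
  shows "of_real h / (2 * of_real m * i1) = Bicomplex 0 (- (h / (2 * m))) 0 0"
proof -
  \<comment> \<open>Gives the components of the numeral by way of \<open>bc_of_real\<close>.\<close>
  have "2 = (of_real 2 :: bicomplex)" by simp
  then have "inverse (2 * of_real m * i1) = Bicomplex 0 (- (1 / (2 * m))) 0 0"
    using assms
    by (intro bicomplex_inverse_eqI) (simp only: bicomplex_eq_iff bc_ring_simps bc_of_real,
        simp add: i1_def)
  then show ?thesis
    by (simp add: divide_bicomplex_def bicomplex_eq_iff)
qed

text \<open>In polar form the current is the density exp (2 a) times the gradient of the phase b,
  scaled by h / m.\<close>

lemma current_exp_C_i1:
  assumes m: "m \<noteq> 0"
    and a: "(\<lambda>x. a (x, snd p)) differentiable at (fst p)"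
    and b: "(\<lambda>x. b (x, snd p)) differentiable at (fst p)"
  shows "current h m (\<lambda>q. bc_of_complex (exp (Complex (a q) (b q))))
           (\<lambda>q. bc_of_complex (cnj (exp (Complex (a q) (b q))))) p
         = of_real (h / m * exp (2 * a p) * pdx b p)"
proof -
  obtain x t where p: "p = (x, t)" by (cases p)
  obtain a' b' where a': "((\<lambda>x. a (x, t)) has_real_derivative a') (at x)"
    and b': "((\<lambda>x. b (x, t)) has_real_derivative b') (at x)"
    using a b by (auto simp: p real_differentiable_def)
  let ?r = "exp (a p)" and ?c = "cos (b p)" and ?s = "sin (b p)"
  have pdx_b: "pdx b p = b'"
    using DERIV_imp_deriv[OF b'] by (simp add: pdx_def p)
  have re: "pdx (\<lambda>q. exp (a q) * cos (b q)) p = ?r * (a' * ?c - b' * ?s)"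
    unfolding pdx_def p fst_conv snd_conv
    by (rule DERIV_imp_deriv) (auto intro!: derivative_eq_intros a' b' simp: algebra_simps)
  have im: "pdx (\<lambda>q. exp (a q) * sin (b q)) p = ?r * (a' * ?s + b' * ?c)"
    unfolding pdx_def p fst_conv snd_conv
    by (rule DERIV_imp_deriv) (auto intro!: derivative_eq_intros a' b' simp: algebra_simps)
  have im': "pdx (\<lambda>q. - (exp (a q) * sin (b q))) p = - (?r * (a' * ?s + b' * ?c))"
    unfolding pdx_def p fst_conv snd_conv
    by (rule DERIV_imp_deriv) (auto intro!: derivative_eq_intros a' b' simp: algebra_simps)
  have zero: "pdx (\<lambda>q. 0) p = 0"
    by (simp add: pdx_def)
  have unit: "?c * ?c + ?s * ?s = 1"
    using sin_cos_squared_add2[of "b p"] by (simp add: power2_eq_square)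
  \<comment> \<open>The terms in \<open>a'\<close> cancel, so the growth of the amplitude
    contributes nothing to the current.\<close>
  have real_part: "(?r * ?c) * (?r * (a' * ?s + b' * ?c)) - (?r * ?s) * (?r * (a' * ?c - b' * ?s))
      = ?r * ?r * b'"
  proof -
    have "(?r * ?c) * (?r * (a' * ?s + b' * ?c)) - (?r * ?s) * (?r * (a' * ?c - b' * ?s))
      = ?r * ?r * b' * (?c * ?c + ?s * ?s)" by algebra
    then show ?thesis by (simp only: unit mult_1_right)
  qed
  have exp2: "exp (2 * a p) = ?r * ?r"
    by (simp only: mult_2 exp_add)
  let ?z = "exp (Complex (a p) (b p))"
    and ?w = "Complex (?r * (a' * ?c - b' * ?s)) (?r * (a' * ?s + b' * ?c))"
  have dx: "bpdx (\<lambda>q. bc_of_complex (exp (Complex (a q) (b q)))) p = bc_of_complex ?w"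
    "bpdx (\<lambda>q. bc_of_complex (cnj (exp (Complex (a q) (b q))))) p = bc_of_complex (cnj ?w)"
    by (simp_all add: bicomplex_eq_iff bpdx_def o_def Re_exp Im_exp re im im' zero)
  \<comment> \<open>A number minus its conjugate is purely imaginary; its \<open>i1\<close> later
    meets the \<open>- i1\<close> of the prefactor, which makes the current real.\<close>
  have wronskian: "bc_of_complex (cnj z) * bc_of_complex w - bc_of_complex z * bc_of_complex (cnj w)
      = Bicomplex 0 (2 * (Re z * Im w - Im z * Re w)) 0 0" for z w
    by (simp add: bicomplex_eq_iff)
  have diff: "bc_of_complex (cnj ?z) * bpdx (\<lambda>q. bc_of_complex (exp (Complex (a q) (b q)))) p
      - bc_of_complex ?z * bpdx (\<lambda>q. bc_of_complex (cnj (exp (Complex (a q) (b q))))) p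
      = Bicomplex 0 (2 * (?r * ?r * b')) 0 0"
    unfolding dx wronskian using real_part by (simp only: Re_exp Im_exp complex.sel)
  show ?thesis
    unfolding current_def diff divide_2_of_real_i1[OF m]
    using m by (simp add: bicomplex_eq_iff pdx_b exp2)
qed

text \<open>Common core of (b) and (c), applied with (a, b) equal to (\<alpha> + \<delta>, \<beta> -
  \<gamma>) and (\<alpha> - \<delta>, \<beta> + \<gamma>). Differentiability in x suffices because
  the time derivative is carried along unevaluated.\<close>

lemma E_lhs_J_exp_C_i1:
  fixes a b :: "real \<times> real \<Rightarrow> real"
  assumes m: "m \<noteq> 0"
    and a: "\<And>x t. (\<lambda>x. a (x, t)) differentiable at x"
    and b: "\<And>x t. (\<lambda>x. b (x, t)) differentiable at x"
    and \<phi>_eq: "\<phi> = (\<lambda>p. exp (of_real (a p) + of_real (b p) * i1))"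
  shows "range \<phi> \<subseteq> C_i1"
    and "E1_lhs h m \<phi> = (\<lambda>p. bpdt (\<lambda>q. \<phi> q * cnj_i1 (\<phi> q)) p + bpdx (J h m \<phi>) p)"
    and "E2_lhs h m \<phi> = (\<lambda>p. bpdt (\<lambda>q. \<phi> q * cnj_i1 (\<phi> q)) p + bpdx (J h m \<phi>) p)"
    and "J h m \<phi> = (\<lambda>p. of_real (h / m * exp (2 * a p) * pdx b p))"
proof -
  have \<phi>: "\<phi> = (\<lambda>q. bc_of_complex (exp (Complex (a q) (b q))))"
    by (simp add: \<phi>_eq exp_C_i1)
  show "range \<phi> \<subseteq> C_i1"
    by (auto simp: \<phi> bc_of_complex_in_C_i1)
  \<comment> \<open>With equal partner functions the two left-hand sides coincide before anything is
    differentiated.\<close>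
  have conj: "dag1 \<circ> \<phi> = cnj_i1 \<circ> \<phi>" "dag3 \<circ> \<phi> = cnj_i1 \<circ> \<phi>"
    by (simp_all add: fun_eq_iff \<phi> bc_of_complex_conjugations)
  show "E1_lhs h m \<phi> = (\<lambda>p. bpdt (\<lambda>q. \<phi> q * cnj_i1 (\<phi> q)) p + bpdx (J h m \<phi>) p)"
    "E2_lhs h m \<phi> = (\<lambda>p. bpdt (\<lambda>q. \<phi> q * cnj_i1 (\<phi> q)) p + bpdx (J h m \<phi>) p)"
    unfolding E1_lhs_def E2_lhs_def conj by (simp_all add: continuity_lhs_def J_def)
  show "J h m \<phi> = (\<lambda>p. of_real (h / m * exp (2 * a p) * pdx b p))"
    using current_exp_C_i1[OF m a b]
    by (simp add: J_def fun_eq_iff o_def \<phi> bc_of_complex_conjugations)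
qed

theorem mainTheorem3:
  fixes hbar m :: real and \<alpha> \<beta> \<gamma> \<delta> :: "real \<times> real \<Rightarrow> real"
    and \<psi> \<psi>p \<psi>m P1 P2 P3 :: "real \<times> real \<Rightarrow> bicomplex"
  assumes "hbar > 0" and "m > 0"
    and "smooth \<alpha>" and "smooth \<beta>" and "smooth \<gamma>" and "smooth \<delta>"
  defines "\<psi> \<equiv> psi \<alpha> \<beta> \<gamma> \<delta>"
    and "\<psi>p \<equiv> psi_plus \<alpha> \<beta> \<gamma> \<delta>" and "\<psi>m \<equiv> psi_minus \<alpha> \<beta> \<gamma> \<delta>"
    and "P1 \<equiv> phat1 \<alpha> \<beta> \<gamma> \<delta>" and "P2 \<equiv> phat2 \<alpha> \<beta> \<gamma> \<delta>" and "P3 \<equiv> phat3 \<alpha> \<beta> \<gamma> \<delta>"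
  shows
    "(P1 = dag2 \<circ> \<psi> \<and> P2 = \<psi>p \<and> P3 = \<psi>m \<and> range \<psi>p \<subseteq> C_i1 \<and> range \<psi>m \<subseteq> C_i1) \<and>
     (E1_lhs hbar m P1 = continuity_lhs hbar m (dag2 \<circ> \<psi>) (dag3 \<circ> \<psi>) \<and>
      (E1 hbar m P1 \<longleftrightarrow> continuity_eq hbar m (dag2 \<circ> \<psi>) (dag3 \<circ> \<psi>)) \<and>
      E2_lhs hbar m P1 = continuity_lhs hbar m (dag2 \<circ> \<psi>) (dag1 \<circ> \<psi>) \<and>
      (E2 hbar m P1 \<longleftrightarrow> continuity_eq hbar m (dag2 \<circ> \<psi>) (dag1 \<circ> \<psi>))) \<and>
     (E1_lhs hbar m P2 = (\<lambda>p. bpdt (\<lambda>q. \<psi>p q * cnj_i1 (\<psi>p q)) p + bpdx (J hbar m \<psi>p) p) \<and>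
      (E1 hbar m P2 \<longleftrightarrow> (\<forall>p. bpdt (\<lambda>q. \<psi>p q * cnj_i1 (\<psi>p q)) p + bpdx (J hbar m \<psi>p) p = 0)) \<and>
      E2_lhs hbar m P2 = (\<lambda>p. bpdt (\<lambda>q. \<psi>p q * cnj_i1 (\<psi>p q)) p + bpdx (J hbar m \<psi>p) p) \<and>
      (E2 hbar m P2 \<longleftrightarrow> (\<forall>p. bpdt (\<lambda>q. \<psi>p q * cnj_i1 (\<psi>p q)) p + bpdx (J hbar m \<psi>p) p = 0)) \<and>
      J hbar m \<psi>p =
        (\<lambda>p. of_real (hbar / m * exp (2 * (\<alpha> p + \<delta> p)) * pdx (\<lambda>q. \<beta> q - \<gamma> q) p)) \<and>
      (\<forall>p. J hbar m \<psi>p p \<in> \<real>)) \<and>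
     (E1_lhs hbar m P3 = (\<lambda>p. bpdt (\<lambda>q. \<psi>m q * cnj_i1 (\<psi>m q)) p + bpdx (J hbar m \<psi>m) p) \<and>
      (E1 hbar m P3 \<longleftrightarrow> (\<forall>p. bpdt (\<lambda>q. \<psi>m q * cnj_i1 (\<psi>m q)) p + bpdx (J hbar m \<psi>m) p = 0)) \<and>
      E2_lhs hbar m P3 = (\<lambda>p. bpdt (\<lambda>q. \<psi>m q * cnj_i1 (\<psi>m q)) p + bpdx (J hbar m \<psi>m) p) \<and>
      (E2 hbar m P3 \<longleftrightarrow> (\<forall>p. bpdt (\<lambda>q. \<psi>m q * cnj_i1 (\<psi>m q)) p + bpdx (J hbar m \<psi>m) p = 0)) \<and>
      J hbar m \<psi>m =
        (\<lambda>p. of_real (hbar / m * exp (2 * (\<alpha> p - \<delta> p)) * pdx (\<lambda>q. \<beta> q + \<gamma> q) p)) \<and>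
      (\<forall>p. J hbar m \<psi>m p \<in> \<real>))"
proof -
  have m: "m \<noteq> 0" using \<open>m > 0\<close> by simp
  note diff = assms(3-6)[THEN smooth_imp_differentiable_x]
  note plus = E_lhs_J_exp_C_i1[OF m differentiable_add[OF diff(1,4)]
      differentiable_diff[OF diff(2,3)]
      psi_plus_def, folded \<psi>p_def]
  note minus = E_lhs_J_exp_C_i1[OF m differentiable_diff[OF diff(1,4)]
      differentiable_add[OF diff(2,3)]
      psi_minus_def, folded \<psi>m_def]
  have P: "P1 = dag2 \<circ> \<psi>" "P2 = \<psi>p" "P3 = \<psi>m"
    unfolding P1_def P2_def P3_def \<psi>_def \<psi>p_def \<psi>m_def
    by (rule phat1_eq_dag2_psi phat2_eq_psi_plus phat3_eq_psi_minus)+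
  have E: "E1_lhs hbar m (dag2 \<circ> \<psi>) = continuity_lhs hbar m (dag2 \<circ> \<psi>) (dag3 \<circ> \<psi>)"
    "E2_lhs hbar m (dag2 \<circ> \<psi>) = continuity_lhs hbar m (dag2 \<circ> \<psi>) (dag1 \<circ> \<psi>)"
    by (simp_all only: E1_lhs_def E2_lhs_def dag_comp_dag2)
  show ?thesis
    \<comment> \<open>After this rewriting both sides of each equivalence are the same formula. What
      reflexivity and the cited facts leave open is the reality of the currents, read off from their
      \<open>of_real\<close> form.\<close>
    unfolding P E1_def E2_def continuity_eq_def E plus(2,3) minus(2,3)
    by (intro conjI refl allI plus(1,4) minus(1,4)) (simp_all only: plus(4) minus(4) Reals_of_real)
qed

end
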